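(* Let $n$ be a positive integer, let $t$ be an integer, and let $b=\lfloor\log_2 n\rfloor+2$. Then evaluating the expansion of $(t+1+x_1)^n\in\mathcal{K}_b$ at $x_1=x_2=\cdots=x_b=1$ equals $\mathfrak{B}_t\left(\binom{2n}{n}\right)$, the $t$-th binomial transform of the central binomial coefficient sequence terms $\binom{2k}{k}$, with $k$ ranging from $0$ to $n$.
   Context: For a positive integer $N$, let $\mathcal{K}_N=\mathbb{Z}[x_1,\ldots,x_N]/I$ with $I=\langle x_1^2-P_1,\ldots,x_N^2-P_N\rangle$, where $P_i=2x_i+x_{i+1}$ for $1\le i<N$ and $P_N=0$. Thus $x_i^2=2x_i+x_{i+1}$ for $1\le i<N$ and $x_N^2=0$ in $\mathcal{K}_N$. The expansion of an element of $\mathcal{K}_N$ is its fully reduced representative: the unique polynomial in $\mathbb{Z}[x_1,\ldots,x_N]$ of degree at most $1$ in each variable $x_i$ that represents it modulo $I$. Evaluating the expansion at $x_1=\cdots=x_N=1$ means summing the coefficients of this representative. Binomial transform: for an integer sequence $a=\{a_0,a_1,a_2,\ldots\}$ and $t\in\mathbb{Z}$, the $t$-th binomial transform is $$\mathfrak{B}_t(a_n)=\begin{cases}a_n & t=0\\ \sum_{k=0}^n\binom{n}{k}a_k & t=1\\ \sum_{k=0}^n\binom{n}{k}\mathfrak{B}_{t-1}(a_k) & t>1\\ \sum_{k=0}^n\binom{n}{k}(-1)^{n-k}a_k & t=-1\\ \sum_{k=0}^n\binom{n}{k}(-1)^{n-k}\mathfrak{B}_{t+1}(a_k) & t<-1.\end{cases}$$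 Here it is applied to $a_k=\binom{2k}{k}$. *)

theory Defs
  imports Complex_Main "HOL-Library.Poly_Mapping" "HOL-Algebra.QuotRing"
begin

text \<open>
  Integer polynomials are finitely supported maps from monomials to coefficients, a monomial being
  a finitely supported map from variable indices to exponents. The instances of
  \<open>HOL-Library.Poly_Mapping\<close> make \<open>*\<close> the usual (convolution) product of polynomials.
\<close>

type_synonym int_mpoly = "(nat \<Rightarrow>\<^sub>0 nat) \<Rightarrow>\<^sub>0 int"

definition var :: "nat \<Rightarrow> int_mpoly"
  where "var i = Poly_Mapping.single (Poly_Mapping.single i 1) 1"

definition mpoly_eval :: "(nat \<Rightarrow> int) \<Rightarrow> int_mpoly \<Rightarrow> int"
  where "mpoly_eval f p =
    (\<Sum>m\<in>Poly_Mapping.keys p. Poly_Mapping.lookup p m *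
       (\<Prod>i\<in>Poly_Mapping.keys m. f i ^ Poly_Mapping.lookup m i))"

text \<open>
  The type provides infinitely many variables. The carrier below consists of the polynomials in
  \<open>var 1, \<dots>, var N\<close> only; \<open>var 0\<close> is never used.
\<close>

definition poly_ring :: "nat \<Rightarrow> int_mpoly ring"
  where "poly_ring N =
    \<lparr>carrier = {p. \<forall>m\<in>Poly_Mapping.keys p. Poly_Mapping.keys m \<subseteq> {1..N}},
     mult = (*), one = 1, zero = 0, add = (+)\<rparr>"

definition P :: "nat \<Rightarrow> nat \<Rightarrow> int_mpoly"
  where "P N i = (if i < N then 2 * var i + var (i + 1) else 0)"

definition relation_ideal :: "nat \<Rightarrow> int_mpoly set"
  where "relation_ideal N = Idl\<^bsub>poly_ring N\<^esub> {var i ^ 2 - P N i | i. i \<in> {1..N}}"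

definition K :: "nat \<Rightarrow> int_mpoly set ring"
  where "K N = poly_ring N Quot relation_ideal N"

definition residue_class :: "nat \<Rightarrow> int_mpoly \<Rightarrow> int_mpoly set"
  where "residue_class N p = relation_ideal N +>\<^bsub>poly_ring N\<^esub> p"

text \<open>
  An element of \<open>K N\<close> is a coset, that is, the set of all polynomials representing it.
\<close>

definition expansion :: "nat \<Rightarrow> int_mpoly set \<Rightarrow> int_mpoly"
  where "expansion N c =
    (THE r. r \<in> c \<and> (\<forall>m\<in>Poly_Mapping.keys r. \<forall>i\<in>{1..N}. Poly_Mapping.lookup m i \<le> 1))"

function binomial_transform :: "int \<Rightarrow> (nat \<Rightarrow> int) \<Rightarrow> nat \<Rightarrow> int"
  where "binomial_transform t a n =
    (if t = 0 then a n
     else if t = 1 then (\<Sum>k=0..n. int (n choose k) * a k)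
     else if t > 1 then (\<Sum>k=0..n. int (n choose k) * binomial_transform (t - 1) a k)
     else if t = -1 then (\<Sum>k=0..n. int (n choose k) * (-1) ^ (n - k) * a k)
     else (\<Sum>k=0..n. int (n choose k) * (-1) ^ (n - k) * binomial_transform (t + 1) a k))"
  by auto
termination by (relation "measure (\<lambda>(t, _, _). nat \<bar>t\<bar>)") auto

declare binomial_transform.simps [simp del]

lemma var_closed: "1 \<le> i \<Longrightarrow> i \<le> N \<Longrightarrow> var i \<in> carrier (poly_ring N)"
  by (auto simp: var_def poly_ring_def)

lemma add_closed:
  "p \<in> carrier (poly_ring N) \<Longrightarrow> q \<in> carrier (poly_ring N) \<Longrightarrow> p + q \<in> carrier (poly_ring N)"
  using Poly_Mapping.keys_add[of p q] by (auto simp: poly_ring_def)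

lemma uminus_closed: "p \<in> carrier (poly_ring N) \<Longrightarrow> - p \<in> carrier (poly_ring N)"
  by (simp add: poly_ring_def)

lemma mult_closed:
  assumes "p \<in> carrier (poly_ring N)" "q \<in> carrier (poly_ring N)"
  shows "p * q \<in> carrier (poly_ring N)"
proof -
  have "Poly_Mapping.keys m \<subseteq> {1..N}" if m_in: "m \<in> Poly_Mapping.keys (p * q)" for m
  proof -
    obtain u v where m: "m = u + v" and "u \<in> Poly_Mapping.keys p" "v \<in> Poly_Mapping.keys q"
      using m_in Poly_Mapping.keys_mult[of p q] by blast
    then have "Poly_Mapping.keys u \<subseteq> {1..N}" "Poly_Mapping.keys v \<subseteq> {1..N}"
      using assms by (auto simp: poly_ring_def)
    then show ?thesis
      using Poly_Mapping.keys_add[of u v] unfolding m by blast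
  qed
  then show ?thesis by (simp add: poly_ring_def)
qed

lemma of_int_closed: "of_int c \<in> carrier (poly_ring N)"
  by (auto simp: poly_ring_def in_keys_iff lookup_of_int)

lemma poly_ring_simps [simp]:
  "p \<oplus>\<^bsub>poly_ring N\<^esub> q = p + q" "p \<otimes>\<^bsub>poly_ring N\<^esub> q = p * q"
  "\<zero>\<^bsub>poly_ring N\<^esub> = 0" "\<one>\<^bsub>poly_ring N\<^esub> = 1"
  by (simp_all add: poly_ring_def)

lemma cring_poly_ring: "cring (poly_ring N)"
proof (rule cringI)
  show "abelian_group (poly_ring N)"
  proof (rule abelian_groupI)
    fix p assume p: "p \<in> carrier (poly_ring N)"
    show "\<exists>q\<in>carrier (poly_ring N). q \<oplus>\<^bsub>poly_ring N\<^esub> p = \<zero>\<^bsub>poly_ring N\<^esub>"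
      by (rule bexI[OF _ uminus_closed[OF p]]) simp
  qed (use of_int_closed[of 0 N] in \<open>simp_all add: add_closed add.assoc add.commute\<close>)
  show "comm_monoid (poly_ring N)"
    by (rule comm_monoidI)
      (use of_int_closed[of 1 N] in \<open>simp_all add: mult_closed mult.assoc mult.commute\<close>)
qed (simp add: distrib_right)

lemma generator_closed:
  assumes "i \<in> {1..N}"
  shows "var i ^ 2 - P N i \<in> carrier (poly_ring N)"
proof -
  have "P N i \<in> carrier (poly_ring N)"
    using assms of_int_closed[of 2 N] of_int_closed[of 0 N]
    by (auto simp: P_def intro!: add_closed mult_closed var_closed)
  moreover have "var i ^ 2 \<in> carrier (poly_ring N)"
    using assms by (auto simp: power2_eq_square intro!: mult_closed var_closed)
  ultimately show ?thesis
    using add_closed[OF _ uminus_closed, of "var i ^ 2" N "P N i"] by simp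
qed

lemma ideal_relation_ideal: "ideal (relation_ideal N) (poly_ring N)"
  unfolding relation_ideal_def
  by (rule ring.genideal_ideal) (use cring_poly_ring generator_closed in \<open>auto simp: cring_def simp del: One_nat_def\<close>)

lemma cring_K: "cring (K N)"
  unfolding K_def by (rule ideal.quotient_is_cring[OF ideal_relation_ideal cring_poly_ring])

end

theory Submission
  imports Defs "HOL-Computational_Algebra.Polynomial" "HOL-Library.Nat_Bijection"
begin

text \<open>
  Put \<open>x\<^sub>i = 1 + y\<^sub>i\<close>. The relation \<open>x\<^sub>i\<^sup>2 = 2 x\<^sub>i + x\<^sub>i\<^sub>+\<^sub>1\<close> becomes \<open>y\<^sub>i\<^sup>2 = 2 + y\<^sub>i\<^sub>+\<^sub>1\<close>, which is
  solved by \<open>y\<^sub>i = z^(2^(i-1)) + z^(-(2^(i-1)))\<close>. In a product of distinct \<open>y\<^sub>i\<close> every power of \<open>z\<close>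
  has the form \<open>\<Sum> \<plusminus>2^(i-1)\<close> over a nonempty set of indices, so it is nontrivial. Hence each
  multilinear monomial in the \<open>x\<^sub>i\<close> has constant term 1 as a Laurent polynomial in \<open>z\<close>, and
  evaluating a multilinear polynomial at \<open>x\<^sub>1 = \<dots> = 1\<close> is the same as taking the constant term of
  its Laurent image (\<open>mpoly_eval_multilinear_eq_constant_term\<close>). Now \<open>t + 1 + x\<^sub>1\<close> is sent to
  \<open>t + (1 + z)\<^sup>2 / z\<close>, and the constant term of \<open>((1 + z)\<^sup>2 / z)^k\<close> is the central binomial coefficient.
  Expanding the \<open>n\<close>-th power of the sum by the binomial theorem gives the \<open>t\<close>-th binomial transform
  (\<open>binomial_transform_lookup_power\<close>).

  The last relation \<open>x\<^sub>N\<^sup>2 = 0\<close> is not satisfied by the Laurent polynomials, so one must know that it does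
  not interfere. Eliminating \<open>x\<^sub>2, \<dots>, x\<^sub>N\<close> turns \<open>x\<^sub>i\<close> into a monic polynomial of degree \<open>2^(i-1)\<close> in
  \<open>x = x\<^sub>1\<close>, and sends the ideal into the multiples of a monic polynomial of degree \<open>2^N\<close>. By uniqueness
  of binary expansions the multilinear monomials acquire the degrees \<open>0, \<dots>, 2^N - 1\<close>, each exactly
  once. So every polynomial in \<open>x\<close> of degree below \<open>2^N\<close> is congruent to exactly one multilinear
  polynomial, and elimination sends the latter back to the former, as an identity and not merely up
  to congruence (\<open>expansion_representative\<close>). This applies to \<open>(t + 1 + x)^n\<close> because \<open>n < 2^b\<close>.
\<close>

section \<open>Substitution homomorphisms\<close>

definition monomial_subst :: "(nat \<Rightarrow> 'a::comm_ring_1) \<Rightarrow> (nat \<Rightarrow>\<^sub>0 nat) \<Rightarrow> 'a"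
  where "monomial_subst f m = (\<Prod>i\<in>Poly_Mapping.keys m. f i ^ Poly_Mapping.lookup m i)"

definition mpoly_subst :: "(nat \<Rightarrow> 'a::comm_ring_1) \<Rightarrow> int_mpoly \<Rightarrow> 'a"
  where "mpoly_subst f p =
    (\<Sum>m\<in>Poly_Mapping.keys p. of_int (Poly_Mapping.lookup p m) * monomial_subst f m)"

lemma monomial_subst_superset:
  assumes "finite A" "Poly_Mapping.keys m \<subseteq> A"
  shows "monomial_subst f m = (\<Prod>i\<in>A. f i ^ Poly_Mapping.lookup m i)"
  unfolding monomial_subst_def
  by (rule prod.mono_neutral_left) (use assms in \<open>auto simp: in_keys_iff\<close>)

lemma monomial_subst_add:
  "monomial_subst f (m + m') = monomial_subst f m * monomial_subst f m'"
proof -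
  let ?A = "Poly_Mapping.keys m \<union> Poly_Mapping.keys m'"
  have "monomial_subst f (m + m') = (\<Prod>i\<in>?A. f i ^ Poly_Mapping.lookup (m + m') i)"
    using Poly_Mapping.keys_add[of m m'] by (intro monomial_subst_superset) auto
  also have "\<dots> = (\<Prod>i\<in>?A. f i ^ Poly_Mapping.lookup m i) * (\<Prod>i\<in>?A. f i ^ Poly_Mapping.lookup m' i)"
    by (simp add: lookup_add power_add prod.distrib)
  also have "\<dots> = monomial_subst f m * monomial_subst f m'"
    by (simp add: monomial_subst_superset[of ?A m] monomial_subst_superset[of ?A m'])
  finally show ?thesis .
qed

lemma mpoly_subst_superset:
  assumes "finite A" "Poly_Mapping.keys p \<subseteq> A"
  shows "mpoly_subst f p = (\<Sum>m\<in>A. of_int (Poly_Mapping.lookup p m) * monomial_subst f m)"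
  unfolding mpoly_subst_def
  by (rule sum.mono_neutral_left) (use assms in \<open>auto simp: in_keys_iff\<close>)

lemma mpoly_subst_0 [simp]: "mpoly_subst f 0 = 0"
  by (simp add: mpoly_subst_def)

lemma mpoly_subst_single: "mpoly_subst f (Poly_Mapping.single m c) = of_int c * monomial_subst f m"
  by (cases "c = 0") (simp_all add: mpoly_subst_def)

lemma mpoly_subst_1 [simp]: "mpoly_subst f 1 = 1"
  using mpoly_subst_single[of f 0 1] by (simp add: monomial_subst_def)

lemma mpoly_subst_var [simp]: "mpoly_subst f (var i) = f i"
  by (simp add: var_def mpoly_subst_single monomial_subst_def)

text \<open>
  Differences come before sums because they, rather than sums, are what the induction principle for
  integer combinations used for multiplicativity asks for.
\<close>

lemma mpoly_subst_diff: "mpoly_subst f (p - q) = mpoly_subst f p - mpoly_subst f q"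
proof -
  let ?A = "Poly_Mapping.keys p \<union> Poly_Mapping.keys q"
  have "mpoly_subst f (p - q) =
      (\<Sum>m\<in>?A. of_int (Poly_Mapping.lookup (p - q) m) * monomial_subst f m)"
    by (intro mpoly_subst_superset) (auto simp: in_keys_iff lookup_minus)
  then show ?thesis
    by (simp add: mpoly_subst_superset[of ?A p] mpoly_subst_superset[of ?A q] lookup_minus
        algebra_simps sum_subtractf)
qed

lemma mpoly_subst_add: "mpoly_subst f (p + q) = mpoly_subst f p + mpoly_subst f q"
  using mpoly_subst_diff[of f p "- q"] mpoly_subst_diff[of f 0 q] by simp

lemma mpoly_subst_mult: "mpoly_subst f (p * q) = mpoly_subst f p * mpoly_subst f q"
proof (rule frag_induction[OF subset_UNIV, of "\<lambda>p. mpoly_subst f (p * q) = mpoly_subst f p * mpoly_subst f q"])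
  fix m :: "nat \<Rightarrow>\<^sub>0 nat"
  show "mpoly_subst f (frag_of m * q) = mpoly_subst f (frag_of m) * mpoly_subst f q"
    by (rule frag_induction[OF subset_UNIV])
      (simp_all add: mult_single mpoly_subst_single monomial_subst_add mpoly_subst_diff algebra_simps)
qed (simp_all add: mpoly_subst_diff algebra_simps)

lemma mpoly_subst_power: "mpoly_subst f (p ^ n) = mpoly_subst f p ^ n"
  by (induction n) (simp_all add: mpoly_subst_mult)

lemma of_int_eq_single: "of_int c = Poly_Mapping.single 0 (c::int)"
  by (metis of_int_eq_id id_apply single_of_int)

lemma mpoly_subst_of_int [simp]: "mpoly_subst f (of_int c) = of_int c"
  by (simp add: of_int_eq_single mpoly_subst_single monomial_subst_def)

definition poly_subst :: "'a::comm_ring_1 \<Rightarrow> int poly \<Rightarrow> 'a"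
  where "poly_subst a h = poly (map_poly of_int h) a"

lemma poly_subst_pCons [simp]: "poly_subst a (pCons c h) = of_int c + a * poly_subst a h"
  by (simp add: poly_subst_def map_poly_pCons)

lemma poly_subst_0 [simp]: "poly_subst a 0 = 0"
  by (simp add: poly_subst_def)

lemma poly_subst_1 [simp]: "poly_subst a 1 = 1"
  by (simp add: poly_subst_def)

lemma poly_subst_add: "poly_subst a (g + h) = poly_subst a g + poly_subst a h"
  by (induction g h rule: poly_induct2) (simp_all add: algebra_simps)

lemma poly_subst_diff: "poly_subst a (g - h) = poly_subst a g - poly_subst a h"
  using poly_subst_add[of a "g - h" h] by (simp add: algebra_simps)

lemma poly_subst_smult: "poly_subst a (smult c h) = of_int c * poly_subst a h"
  by (induction h) (simp_all add: algebra_simps)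

lemma poly_subst_mult: "poly_subst a (g * h) = poly_subst a g * poly_subst a h"
  by (induction g) (simp_all add: poly_subst_add poly_subst_smult algebra_simps)

lemma poly_subst_of_int [simp]: "poly_subst a (of_int c) = of_int c"
  by (simp add: of_int_poly)

lemma poly_subst_power: "poly_subst a (h ^ n) = poly_subst a h ^ n"
  by (induction n) (simp_all add: poly_subst_mult)

lemma poly_subst_prod: "poly_subst a (prod g A) = (\<Prod>i\<in>A. poly_subst a (g i))"
  by (induction A rule: infinite_finite_induct) (simp_all add: poly_subst_mult)

lemma poly_subst_sum: "poly_subst a (sum g A) = (\<Sum>i\<in>A. poly_subst a (g i))"
  by (induction A rule: infinite_finite_induct) (simp_all add: poly_subst_add)

text \<open>
  This lets the Laurent image of a polynomial be computed from its elimination, so that only the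
  elimination has to be controlled modulo the relations.
\<close>

lemma poly_subst_mpoly_subst:
  "poly_subst a (mpoly_subst f p) = mpoly_subst (\<lambda>i. poly_subst a (f i)) p"
  by (simp add: mpoly_subst_def monomial_subst_def poly_subst_sum poly_subst_mult
      poly_subst_prod poly_subst_power)

section \<open>Multilinear polynomials\<close>

definition multilinear :: "nat \<Rightarrow> int_mpoly \<Rightarrow> bool"
  where "multilinear N p \<longleftrightarrow> p \<in> carrier (poly_ring N) \<and>
    (\<forall>m\<in>Poly_Mapping.keys p. \<forall>i\<in>{1..N}. Poly_Mapping.lookup m i \<le> 1)"

lemma multilinear_lookup:
  assumes "multilinear N p" "m \<in> Poly_Mapping.keys p"
  shows "Poly_Mapping.lookup m i = (if i \<in> Poly_Mapping.keys m then 1 else 0)"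
proof (cases "i \<in> Poly_Mapping.keys m")
  case True
  moreover have "Poly_Mapping.keys m \<subseteq> {1..N}"
    using assms by (simp add: multilinear_def poly_ring_def)
  ultimately have "i \<in> {1..N}" by blast
  then have "Poly_Mapping.lookup m i \<le> 1" using assms by (auto simp: multilinear_def)
  with True show ?thesis by (auto simp: in_keys_iff)
qed (auto simp: in_keys_iff)

lemma multilinear_monomial_subst:
  assumes "multilinear N p" "m \<in> Poly_Mapping.keys p"
  shows "monomial_subst f m = prod f (Poly_Mapping.keys m)"
  unfolding monomial_subst_def
  by (rule prod.cong) (simp_all add: multilinear_lookup[OF assms])

lemma multilinear_keys:
  assumes "multilinear N p" "m \<in> Poly_Mapping.keys p"
  shows "Poly_Mapping.keys m \<subseteq> {1..N}"
  using assms by (auto simp: multilinear_def poly_ring_def)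

lemma multilinear_0: "multilinear N 0"
  using of_int_closed[of 0 N] by (simp add: multilinear_def)

lemma multilinear_add:
  assumes "multilinear N p" "multilinear N q"
  shows "multilinear N (p + q)"
  unfolding multilinear_def
proof (intro conjI ballI)
  show "p + q \<in> carrier (poly_ring N)"
    using assms by (intro add_closed) (auto simp: multilinear_def)
  fix m i assume "m \<in> Poly_Mapping.keys (p + q)" "i \<in> {1..N}"
  then show "Poly_Mapping.lookup m i \<le> 1"
    using assms Poly_Mapping.keys_add[of p q] by (auto simp: multilinear_lookup)
qed

lemma multilinear_uminus: "multilinear N p \<Longrightarrow> multilinear N (- p)"
  by (simp add: multilinear_def uminus_closed)

lemma prod_var_eq_single:
  assumes "finite S"
  shows "(\<Prod>i\<in>S. var i) = Poly_Mapping.single (\<Sum>i\<in>S. Poly_Mapping.single i 1) 1"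
  using assms by induction (simp_all add: var_def mult_single)

lemma lookup_sum_single_1:
  assumes "finite S"
  shows "Poly_Mapping.lookup (\<Sum>i\<in>S. Poly_Mapping.single i (1::nat)) j = (if j \<in> S then 1 else 0)"
  using assms by (simp add: lookup_sum lookup_single when_def)

lemma multilinear_of_int_mult_prod_var:
  assumes "S \<subseteq> {1..N}"
  shows "multilinear N (of_int c * (\<Prod>i\<in>S. var i))"
proof -
  have fin: "finite S" using assms finite_subset by blast
  let ?m = "\<Sum>i\<in>S. Poly_Mapping.single i (1::nat)"
  have eq: "of_int c * (\<Prod>i\<in>S. var i) = Poly_Mapping.single ?m c"
    unfolding prod_var_eq_single[OF fin] by (simp add: mult_single of_int_eq_single)
  have keys: "Poly_Mapping.keys ?m = S"
    by (rule Set.set_eqI) (simp add: in_keys_iff lookup_sum_single_1[OF fin] del: One_nat_def)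
  have "Poly_Mapping.keys m \<subseteq> {1..N} \<and> Poly_Mapping.lookup m i \<le> 1"
    if "m \<in> Poly_Mapping.keys (Poly_Mapping.single ?m c)" for m i
  proof -
    have "m = ?m" using that by (simp split: if_splits)
    then show ?thesis using assms keys lookup_sum_single_1[OF fin, of i] by simp
  qed
  then show ?thesis
    unfolding eq multilinear_def poly_ring_def partial_object.select_convs mem_Collect_eq by blast
qed

section \<open>Elimination of all variables but the first\<close>

text \<open>
  The polynomial \<open>chain_poly k\<close> is what the relations make of \<open>x\<^sub>k\<^sub>+\<^sub>1\<close> in terms of \<open>x\<^sub>1\<close>; it
  is \<open>1 + 2 T ((x - 1) / 2)\<close> for the Chebyshev polynomial \<open>T\<close> of index \<open>2^k\<close>.
\<close>

primrec chain_poly :: "nat \<Rightarrow> int poly" where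
  "chain_poly 0 = [:0, 1:]"
| "chain_poly (Suc k) = chain_poly k ^ 2 - 2 * chain_poly k"

definition eliminate :: "int_mpoly \<Rightarrow> int poly"
  where "eliminate = mpoly_subst (\<lambda>i. chain_poly (i - 1))"

lemma monic_minus_lower_degree:
  fixes p q :: "int poly"
  assumes "lead_coeff p = 1" "degree q < degree p"
  shows "degree (p - q) = degree p" "lead_coeff (p - q) = 1"
proof -
  show "degree (p - q) = degree p"
    using assms degree_add_eq_left[of "- q" p] by simp
  then show "lead_coeff (p - q) = 1"
    using assms by (simp add: coeff_eq_0)
qed

lemma chain_poly_degree_monic: "degree (chain_poly k) = 2 ^ k \<and> lead_coeff (chain_poly k) = 1"
proof (induction k)
  case (Suc k)
  let ?q = "chain_poly k"
  have nz: "?q \<noteq> 0" using Suc by auto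
  have "degree (?q ^ 2) = 2 * 2 ^ k"
    using Suc nz by (simp add: degree_power_eq)
  moreover have "lead_coeff (?q ^ 2) = 1"
    unfolding lead_coeff_power using Suc by (metis power_one)
  moreover have "degree (2 * ?q) < 2 * 2 ^ k"
    by (rule le_less_trans[of _ "2 ^ k"]) (use Suc degree_mult_le[of 2 ?q] in simp_all)
  ultimately have "degree (2 * ?q) < degree (?q ^ 2)" "lead_coeff (?q ^ 2) = 1"
    "degree (?q ^ 2) = 2 ^ Suc k" by auto
  then show ?case
    using monic_minus_lower_degree[of "?q ^ 2" "2 * ?q"] by (simp only: chain_poly.simps)
qed simp

text \<open>
  The degree is \<open>\<Sum> 2^(i-1)\<close>. Doubling it absorbs the shift of the index and leaves the binary
  encoding of \<open>S\<close>, through which degrees and sets of variables determine each other.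
\<close>

lemma prod_chain_poly_degree_monic:
  assumes "finite S" "0 \<notin> S"
  shows "2 * degree (\<Prod>i\<in>S. chain_poly (i - 1)) = set_encode S"
    and "lead_coeff (\<Prod>i\<in>S. chain_poly (i - 1)) = 1"
proof -
  have nz: "chain_poly k \<noteq> 0" for k
    using chain_poly_degree_monic[of k] by auto
  have "2 * degree (\<Prod>i\<in>S. chain_poly (i - 1)) = (\<Sum>i\<in>S. 2 * 2 ^ (i - 1))"
    using nz by (simp add: degree_prod_sum_eq chain_poly_degree_monic sum_distrib_left)
  also have "\<dots> = (\<Sum>i\<in>S. 2 ^ i)"
    by (rule sum.cong[OF refl]) (use assms in \<open>metis One_nat_def Suc_pred not_gr_zero power_Suc\<close>)
  finally show "2 * degree (\<Prod>i\<in>S. chain_poly (i - 1)) = set_encode S"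
    by (simp add: set_encode_def)
  show "lead_coeff (\<Prod>i\<in>S. chain_poly (i - 1)) = 1"
    unfolding lead_coeff_prod using chain_poly_degree_monic by (intro prod.neutral) blast
qed

text \<open>
  Distinct multilinear monomials are sent to monic polynomials of distinct degrees, so the largest of
  these degrees cannot cancel.
\<close>

lemma eliminate_multilinear_inj:
  assumes p: "multilinear N p" and "eliminate p = 0"
  shows "p = 0"
proof (rule ccontr)
  assume "p \<noteq> 0"
  let ?keys = "Poly_Mapping.keys p"
  let ?X = "\<lambda>m. \<Prod>i\<in>Poly_Mapping.keys m. chain_poly (i - 1)"
  have deg: "2 * degree (?X m) = set_encode (Poly_Mapping.keys m)"
    and monic: "lead_coeff (?X m) = 1" if "m \<in> ?keys" for m
  proof -
    have "0 \<notin> Poly_Mapping.keys m" using multilinear_keys[OF p that] by auto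
    then show "2 * degree (?X m) = set_encode (Poly_Mapping.keys m)" "lead_coeff (?X m) = 1"
      by (intro prod_chain_poly_degree_monic; simp)+
  qed
  obtain m where m: "m \<in> ?keys" and max: "\<And>m'. m' \<in> ?keys \<Longrightarrow> degree (?X m') \<le> degree (?X m)"
  proof -
    have "Max ((\<lambda>m. degree (?X m)) ` ?keys) \<in> (\<lambda>m. degree (?X m)) ` ?keys"
      using \<open>p \<noteq> 0\<close> by (intro Max_in) auto
    then obtain m where "m \<in> ?keys" "degree (?X m) = Max ((\<lambda>m. degree (?X m)) ` ?keys)"
      by auto
    then show thesis using that[of m] by (simp del: One_nat_def)
  qed
  have lower: "degree (?X m') < degree (?X m)" if "m' \<in> ?keys" "m' \<noteq> m" for m'
  proof (rule ccontr)
    assume "\<not> degree (?X m') < degree (?X m)"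
    then have "degree (?X m') = degree (?X m)" using max[OF that(1)] by simp
    then have "set_encode (Poly_Mapping.keys m') = set_encode (Poly_Mapping.keys m)"
      using deg[OF m] deg[OF that(1)] by simp
    then have "Poly_Mapping.keys m' = Poly_Mapping.keys m"
      by (simp add: set_encode_eq)
    then have "m' = m"
      by (intro poly_mapping_eqI) (simp add: multilinear_lookup[OF p m] multilinear_lookup[OF p that(1)])
    with that show False by simp
  qed
  have "coeff (eliminate p) (degree (?X m)) =
      (\<Sum>m'\<in>?keys. Poly_Mapping.lookup p m' * coeff (?X m') (degree (?X m)))"
    by (simp add: eliminate_def mpoly_subst_def multilinear_monomial_subst[OF p] coeff_sum of_int_poly
        del: One_nat_def)
  also have "\<dots> = (\<Sum>m'\<in>?keys. if m' = m then Poly_Mapping.lookup p m' else 0)"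
    by (rule sum.cong[OF refl]) (use lower monic[OF m] in \<open>auto simp: coeff_eq_0\<close>)
  also have "\<dots> = Poly_Mapping.lookup p m"
    using m by simp
  finally show False using m \<open>eliminate p = 0\<close> by (simp add: in_keys_iff)
qed

lemma eliminate_multilinear_degree:
  assumes p: "multilinear N p"
  shows "degree (eliminate p) < 2 ^ N"
proof -
  have "degree (of_int c * (\<Prod>i\<in>S. chain_poly (i - 1))) < 2 ^ N" if S: "S \<subseteq> {1..N}" for S c
  proof -
    have fin: "finite S" using S finite_subset by blast
    have "2 * degree (\<Prod>i\<in>S. chain_poly (i - 1)) = set_encode S"
      by (rule prod_chain_poly_degree_monic) (use S fin in auto)
    also have "\<dots> \<le> (\<Sum>i\<in>{1..N}. 2 ^ i)"
      unfolding set_encode_def by (rule sum_mono2) (use S in auto)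
    also have "\<dots> < 2 * 2 ^ N"
      by (induction N) auto
    finally show ?thesis
      using degree_smult_le[of c "\<Prod>i\<in>S. chain_poly (i - 1)"] by (simp add: of_int_poly)
  qed
  then show ?thesis
    unfolding eliminate_def mpoly_subst_def using multilinear_keys[OF p]
    by (intro degree_sum_less) (simp_all add: multilinear_monomial_subst[OF p] del: One_nat_def)
qed

section \<open>The relation ideal\<close>

lemma relation_ideal_add: "p \<in> relation_ideal N \<Longrightarrow> q \<in> relation_ideal N \<Longrightarrow> p + q \<in> relation_ideal N"
  using additive_subgroup.a_closed[OF ideal.axioms(1)[OF ideal_relation_ideal]] by fastforce

lemma relation_ideal_mult:
  "p \<in> carrier (poly_ring N) \<Longrightarrow> q \<in> relation_ideal N \<Longrightarrow> p * q \<in> relation_ideal N"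
  using ideal.I_l_closed[OF ideal_relation_ideal] by fastforce

lemma relation_ideal_carrier: "p \<in> relation_ideal N \<Longrightarrow> p \<in> carrier (poly_ring N)"
  using ideal.Icarr[OF ideal_relation_ideal] by fastforce

lemma relation_ideal_0: "0 \<in> relation_ideal N"
  using additive_subgroup.zero_closed[OF ideal.axioms(1)[OF ideal_relation_ideal, of N]] by simp

lemma relation_ideal_uminus: "p \<in> relation_ideal N \<Longrightarrow> - p \<in> relation_ideal N"
  using relation_ideal_mult[OF of_int_closed[of "-1"]] by fastforce

lemma relation_ideal_diff: "p \<in> relation_ideal N \<Longrightarrow> q \<in> relation_ideal N \<Longrightarrow> p - q \<in> relation_ideal N"
  using relation_ideal_add[OF _ relation_ideal_uminus] by fastforce

lemma relation_ideal_generator: "i \<in> {1..N} \<Longrightarrow> var i ^ 2 - P N i \<in> relation_ideal N"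
  unfolding relation_ideal_def
  using ring.genideal_self[of "poly_ring N" "{var i ^ 2 - P N i | i. i \<in> {1..N}}"]
    cring_poly_ring generator_closed by (fastforce simp: cring_def)

text \<open>
  Elimination annihilates every generator but the last, whose image is the square of the last chain
  polynomial.
\<close>

lemma eliminate_relation_ideal:
  assumes "p \<in> relation_ideal N"
  shows "chain_poly (N - 1) ^ 2 dvd eliminate p"
proof -
  let ?Q = "chain_poly (N - 1) ^ 2"
  let ?J = "{p \<in> carrier (poly_ring N). ?Q dvd eliminate p}"
  interpret R: cring "poly_ring N" by (rule cring_poly_ring)
  have "ideal ?J (poly_ring N)"
  proof (rule idealI)
    show "subgroup ?J (add_monoid (poly_ring N))"
    proof (rule R.add.subgroupI)
      fix p assume "p \<in> ?J"
      moreover have "\<ominus>\<^bsub>poly_ring N\<^esub> p = - p" if "p \<in> carrier (poly_ring N)"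
        by (rule R.minus_equality) (use that in \<open>auto simp: uminus_closed\<close>)
      moreover have "eliminate (- p) = - eliminate p"
        using mpoly_subst_diff[of _ 0 p] by (simp add: eliminate_def)
      ultimately show "\<ominus>\<^bsub>poly_ring N\<^esub> p \<in> ?J"
        using uminus_closed by auto
    next
      have "0 \<in> ?J" using of_int_closed[of 0 N] by (simp add: eliminate_def)
      then show "?J \<noteq> {}" by blast
    qed (auto simp: add_closed eliminate_def mpoly_subst_add)
  qed (auto simp: mult_closed eliminate_def mpoly_subst_mult R.ring_axioms)
  moreover have "{var i ^ 2 - P N i | i. i \<in> {1..N}} \<subseteq> ?J"
  proof safe
    fix i assume i: "i \<in> {1..N}"
    show "var i ^ 2 - P N i \<in> carrier (poly_ring N)" using generator_closed[OF i] .
    show "?Q dvd eliminate (var i ^ 2 - P N i)"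
    proof (cases "i < N")
      case True
      then obtain k where "i = Suc k" using i by (cases i) auto
      then have "eliminate (var i ^ 2 - P N i) = 0"
        using True mpoly_subst_of_int[of "\<lambda>i. chain_poly (i - 1)" 2]
        by (simp add: eliminate_def P_def mpoly_subst_diff mpoly_subst_add mpoly_subst_mult mpoly_subst_power)
      then show ?thesis by simp
    next
      case False
      then show ?thesis using i by (simp add: eliminate_def P_def mpoly_subst_power)
    qed
  qed
  ultimately have "relation_ideal N \<subseteq> ?J"
    unfolding relation_ideal_def by (rule R.genideal_minimal)
  with assms show ?thesis by auto
qed

text \<open>
  The modulus has degree \<open>2^N\<close>, more than the difference can have: a congruence between
  polynomials of low degree is an equality.
\<close>

lemma eliminate_eq_of_cong:
  assumes "N \<ge> 1" "multilinear N r" "degree h < 2 ^ N"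
    and dvd: "chain_poly (N - 1) ^ 2 dvd eliminate r - h"
  shows "eliminate r = h"
proof (rule ccontr)
  assume "eliminate r \<noteq> h"
  then have "degree (chain_poly (N - 1) ^ 2) \<le> degree (eliminate r - h)"
    using dvd by (intro dvd_imp_degree_le) auto
  moreover have "degree (chain_poly (N - 1) ^ 2) = 2 ^ N"
    using chain_poly_degree_monic[of "N - 1"] assms(1)
    by (subst degree_power_eq) (auto simp flip: power_Suc simp del: One_nat_def simp: Suc_pred')
  moreover have "degree (eliminate r - h) < 2 ^ N"
    using eliminate_multilinear_degree[OF assms(2)] assms(3) by (intro degree_diff_less) auto
  ultimately show False by simp
qed

lemma multilinear_unique_mod_relation_ideal:
  assumes "N \<ge> 1" "multilinear N r" "multilinear N s" "r - s \<in> relation_ideal N"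
  shows "r = s"
proof -
  have "chain_poly (N - 1) ^ 2 dvd eliminate r - eliminate s"
    using eliminate_relation_ideal[OF assms(4)] by (simp add: eliminate_def mpoly_subst_diff)
  then have "eliminate r = eliminate s"
    using assms eliminate_multilinear_degree by (intro eliminate_eq_of_cong)
  then have "eliminate (r - s) = 0" by (simp add: eliminate_def mpoly_subst_diff)
  then show ?thesis
    using eliminate_multilinear_inj[OF multilinear_add[OF assms(2) multilinear_uminus[OF assms(3)]]] by simp
qed

lemma poly_subst_var_closed:
  assumes "N \<ge> 1"
  shows "poly_subst (var 1) h \<in> carrier (poly_ring N)"
proof (induction h)
  case 0
  show ?case using of_int_closed[of 0 N] by simp
next
  case (pCons c h)
  then show ?case
    using assms by (auto intro!: add_closed mult_closed of_int_closed var_closed simp del: One_nat_def)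
qed

lemma var_cong_chain_poly:
  assumes "Suc k \<le> N"
  shows "var (Suc k) - poly_subst (var 1) (chain_poly k) \<in> relation_ideal N"
  using assms
proof (induction k)
  case 0
  then show ?case by (simp add: relation_ideal_0)
next
  case (Suc k)
  let ?a = "var (Suc k)" and ?e = "poly_subst (var 1) (chain_poly k)"
  have e: "poly_subst (var 1) (chain_poly (Suc k)) = ?e ^ 2 - 2 * ?e"
    using poly_subst_of_int[of "var 1" 2]
    by (simp add: poly_subst_diff poly_subst_mult poly_subst_power)
  \<comment> \<open>The map \<open>u \<mapsto> u\<^sup>2 - 2 u\<close> changes by \<open>(a + e - 2) (a - e)\<close> between \<open>e\<close> and \<open>a\<close>.\<close>
  have "?a + ?e + of_int (-2) \<in> carrier (poly_ring N)"
    using Suc.prems by (intro add_closed of_int_closed var_closed poly_subst_var_closed) auto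
  then have "(?a + ?e + of_int (-2)) * (?a - ?e) \<in> relation_ideal N"
    using Suc by (intro relation_ideal_mult) auto
  moreover have "?a ^ 2 - P N (Suc k) \<in> relation_ideal N"
    using Suc.prems by (intro relation_ideal_generator) auto
  ultimately have "(?a + ?e + of_int (-2)) * (?a - ?e) - (?a ^ 2 - P N (Suc k)) \<in> relation_ideal N"
    by (rule relation_ideal_diff)
  moreover have "(?a + ?e + of_int (-2)) * (?a - ?e) - (?a ^ 2 - P N (Suc k)) =
      var (Suc (Suc k)) - poly_subst (var 1) (chain_poly (Suc k))"
    unfolding e using Suc.prems by (simp add: P_def algebra_simps power2_eq_square)
  ultimately show ?case by simp
qed

lemma prod_var_cong_chain_poly:
  assumes "S \<subseteq> {1..N}" "N \<ge> 1"
  shows "(\<Prod>i\<in>S. var i) - poly_subst (var 1) (\<Prod>i\<in>S. chain_poly (i - 1)) \<in> relation_ideal N"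
proof -
  have "finite S" using assms finite_subset by blast
  then show ?thesis using assms(1)
  proof induction
    case empty
    then show ?case by (simp add: relation_ideal_0)
  next
    case (insert j S)
    let ?x = "\<Prod>i\<in>S. var i" and ?h = "\<Prod>i\<in>S. chain_poly (i - 1)"
    let ?\<eta> = "poly_subst (var 1)"
    have j: "Suc (j - 1) = j" "j \<le> N" using insert.prems by auto
    have "var j - ?\<eta> (chain_poly (j - 1)) \<in> relation_ideal N"
      using var_cong_chain_poly[of "j - 1" N] j by simp
    then have "?\<eta> ?h * (var j - ?\<eta> (chain_poly (j - 1))) + var j * (?x - ?\<eta> ?h) \<in> relation_ideal N"
      using insert.IH insert.prems assms(2)
      by (intro relation_ideal_add relation_ideal_mult poly_subst_var_closed var_closed) auto
    also have "?\<eta> ?h * (var j - ?\<eta> (chain_poly (j - 1))) + var j * (?x - ?\<eta> ?h) =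
        (\<Prod>i\<in>insert j S. var i) - ?\<eta> (\<Prod>i\<in>insert j S. chain_poly (i - 1))"
      using insert.hyps by (simp add: poly_subst_mult algebra_simps del: One_nat_def)
    finally show ?case .
  qed
qed

text \<open>
  Successive removal of leading terms: the term of degree \<open>k\<close> is cancelled by the multilinear
  monomial whose set of variables is given by the binary digits of \<open>k\<close>.
\<close>

lemma multilinear_representative_exists:
  assumes "N \<ge> 1" "k \<le> 2 ^ N" "\<And>j. j \<ge> k \<Longrightarrow> coeff h j = 0"
  shows "\<exists>r. multilinear N r \<and> r - poly_subst (var 1) h \<in> relation_ideal N"
  using assms(2,3)
proof (induction k arbitrary: h)
  case 0
  then have "h = 0" by (intro poly_eqI) simp
  then show ?case using multilinear_0 relation_ideal_0 by auto
next
  case (Suc k)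
  \<comment> \<open>The factor 2 shifts the digits by one place, as variables are numbered from 1.\<close>
  define S where "S = set_decode (2 * k)"
  have S_bound: "S \<subseteq> {1..N}"
  proof
    fix i assume i: "i \<in> S"
    have "i \<noteq> 0" using i by (auto simp: S_def intro: ccontr)
    moreover have "2 ^ i \<le> set_encode S"
      unfolding set_encode_def by (rule member_le_sum) (use i in \<open>auto simp: S_def\<close>)
    then have "(2::nat) ^ i < 2 ^ Suc N" using Suc.prems(1) by (simp add: S_def)
    then have "i < Suc N" by (rule power_less_imp_less_exp[rotated]) simp
    ultimately show "i \<in> {1..N}" by simp
  qed
  let ?q = "\<Prod>i\<in>S. chain_poly (i - 1)" and ?a = "coeff h k"
  have q: "degree ?q = k" "lead_coeff ?q = 1"
    using prod_chain_poly_degree_monic[of S] S_bound by (auto simp: S_def)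
  have "\<exists>r. multilinear N r \<and> r - poly_subst (var 1) (h - smult ?a ?q) \<in> relation_ideal N"
  proof (rule Suc.IH)
    show "k \<le> 2 ^ N" using Suc.prems(1) by simp
    fix j assume "k \<le> j"
    then show "coeff (h - smult ?a ?q) j = 0"
      using q Suc.prems(2)[of j] by (cases "j = k") (auto simp: coeff_eq_0)
  qed
  then obtain r where r: "multilinear N r"
    "r - poly_subst (var 1) (h - smult ?a ?q) \<in> relation_ideal N" by blast
  let ?r = "r + of_int ?a * (\<Prod>i\<in>S. var i)"
  have "of_int ?a * ((\<Prod>i\<in>S. var i) - poly_subst (var 1) ?q) \<in> relation_ideal N"
    using prod_var_cong_chain_poly[OF S_bound assms(1)] by (intro relation_ideal_mult of_int_closed)
  from relation_ideal_add[OF r(2) this] have "?r - poly_subst (var 1) h \<in> relation_ideal N"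
    by (simp add: poly_subst_diff poly_subst_smult algebra_simps del: One_nat_def)
  moreover have "multilinear N ?r"
    using r(1) S_bound by (intro multilinear_add multilinear_of_int_mult_prod_var)
  ultimately show ?case by blast
qed

lemma mem_residue_class_iff:
  assumes "p \<in> carrier (poly_ring N)"
  shows "r \<in> residue_class N p \<longleftrightarrow> r - p \<in> relation_ideal N"
proof -
  have "r \<in> residue_class N p \<longleftrightarrow> (\<exists>i\<in>relation_ideal N. r = i + p)"
    by (auto simp: residue_class_def a_r_coset_def')
  also have "\<dots> \<longleftrightarrow> r - p \<in> relation_ideal N"
    by (auto intro: bexI[of _ "r - p"])
  finally show ?thesis .
qed

lemma power_closed: "p \<in> carrier (poly_ring N) \<Longrightarrow> p ^ n \<in> carrier (poly_ring N)"
  using of_int_closed[of 1 N] by (induction n) (auto intro: mult_closed)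

lemma residue_class_power:
  assumes p: "p \<in> carrier (poly_ring N)"
  shows "residue_class N p [^]\<^bsub>K N\<^esub> n = residue_class N (p ^ n)"
proof -
  interpret I: ideal "relation_ideal N" "poly_ring N" by (rule ideal_relation_ideal)
  have hom: "(+>\<^bsub>poly_ring N\<^esub>) (relation_ideal N) \<in> ring_hom (poly_ring N) (K N)"
    unfolding K_def by (rule I.rcos_ring_hom)
  show ?thesis
  proof (induction n)
    case 0
    then show ?case using ring_hom_one[OF hom] by (simp add: residue_class_def)
  next
    case (Suc n)
    then show ?case
      using ring_hom_mult[OF hom power_closed[OF p] p, of n]
      by (simp add: residue_class_def mult.commute)
  qed
qed

text \<open>
  The first part says that the definite description of the expansion is met; the second determines
  the expansion completely, since elimination is injective on multilinear polynomials.
\<close>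

lemma expansion_representative:
  assumes "N \<ge> 1" "degree h < 2 ^ N"
  shows "multilinear N (expansion N (residue_class N (poly_subst (var 1) h)))"
    and "eliminate (expansion N (residue_class N (poly_subst (var 1) h))) = h"
proof -
  let ?p = "poly_subst (var 1) h"
  let ?r = "expansion N (residue_class N ?p)"
  have p: "?p \<in> carrier (poly_ring N)" using poly_subst_var_closed[OF assms(1)] .
  have iff: "r \<in> residue_class N ?p \<and> (\<forall>m\<in>Poly_Mapping.keys r. \<forall>i\<in>{1..N}. Poly_Mapping.lookup m i \<le> 1)
      \<longleftrightarrow> multilinear N r \<and> r - ?p \<in> relation_ideal N" for r
    unfolding mem_residue_class_iff[OF p] multilinear_def
    using add_closed[OF relation_ideal_carrier p, of "r - ?p"] by auto
  obtain r where r: "multilinear N r" "r - ?p \<in> relation_ideal N"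
    using multilinear_representative_exists[OF assms(1) order_refl, of h] assms(2) coeff_eq_0[of h]
    by (meson order_less_le_trans)
  have "?r = r"
    unfolding expansion_def iff
  proof (rule the_equality)
    fix s assume s: "multilinear N s \<and> s - ?p \<in> relation_ideal N"
    have "s - r \<in> relation_ideal N"
      using relation_ideal_diff[of "s - ?p" N "r - ?p"] s r by simp
    then show "s = r"
      using multilinear_unique_mod_relation_ideal[OF assms(1)] s r by blast
  qed (use r in simp)
  moreover have "eliminate r = h"
  proof (rule eliminate_eq_of_cong[OF assms(1) r(1) assms(2)])
    have "eliminate ?p = h"
    proof (induction h)
      case 0
      then show ?case by (simp add: eliminate_def)
    next
      case (pCons c h)
      then show ?case
        by (simp add: eliminate_def mpoly_subst_add mpoly_subst_mult of_int_poly)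
    qed
    then show "chain_poly (N - 1) ^ 2 dvd eliminate r - h"
      using eliminate_relation_ideal[OF r(2)] by (simp add: eliminate_def mpoly_subst_diff)
  qed
  ultimately show "multilinear N ?r" "eliminate ?r = h" using r(1) by simp_all
qed

section \<open>Constant terms of Laurent polynomials\<close>

type_synonym laurent = "int \<Rightarrow>\<^sub>0 int"

abbreviation z_power :: "int \<Rightarrow> laurent"
  where "z_power k \<equiv> Poly_Mapping.single k 1"

lemma lookup_z_power_mult:
  "Poly_Mapping.lookup (z_power k * p) j = Poly_Mapping.lookup p (j - k)"
proof (rule frag_induction[OF subset_UNIV, of "\<lambda>p. Poly_Mapping.lookup (z_power k * p) j = Poly_Mapping.lookup p (j - k)"])
qed (auto simp: mult_single lookup_single when_def lookup_minus right_diff_distrib)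

lemma lookup_of_int_mult:
  "Poly_Mapping.lookup (of_int c * p) e = c * Poly_Mapping.lookup (p :: laurent) e"
  by (rule int_induct[of _ 0 c]) (simp_all add: distrib_right lookup_add left_diff_distrib lookup_minus)

lemma z_power_power: "z_power k ^ n = z_power (int n * k)"
  by (induction n) (simp_all add: mult_single algebra_simps)

text \<open>
  Signed sums of distinct powers of 2 vanish only when empty. In the induction the product over the
  exponents below \<open>k\<close> has all its terms strictly between \<open>-(2^k)\<close> and \<open>2^k\<close>, so that shifting it by
  \<open>\<plusminus>2^k\<close> moves every term away from 0.
\<close>

lemma constant_term_prod:
  assumes "S \<subseteq> {..<k}"
  defines "F \<equiv> \<Prod>i\<in>S. 1 + z_power (2 ^ i) + z_power (- (2 ^ i))"
  shows "Poly_Mapping.lookup F 0 = 1 \<and> (\<forall>e. \<bar>e\<bar> \<ge> 2 ^ k \<longrightarrow> Poly_Mapping.lookup F e = 0)"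
  using assms(1) unfolding F_def
proof (induction k arbitrary: S)
  case 0
  then show ?case by (auto simp: lookup_one)
next
  case (Suc k)
  define G where "G = (\<Prod>i\<in>S - {k}. 1 + z_power (2 ^ i) + z_power (- (2 ^ i)))"
  have IH: "Poly_Mapping.lookup G 0 = 1" "\<And>e. \<bar>e\<bar> \<ge> 2 ^ k \<Longrightarrow> Poly_Mapping.lookup G e = 0"
  proof -
    have "S - {k} \<subseteq> {..<k}" using Suc.prems by (auto simp: less_Suc_eq)
    from Suc.IH[OF this] show "Poly_Mapping.lookup G 0 = 1"
      "\<And>e. \<bar>e\<bar> \<ge> 2 ^ k \<Longrightarrow> Poly_Mapping.lookup G e = 0"
      unfolding G_def by blast+
  qed
  have fin: "finite S" using Suc.prems finite_subset by blast
  show ?case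
  proof (cases "k \<in> S")
    case True
    have "(\<Prod>i\<in>S. 1 + z_power (2 ^ i) + z_power (- (2 ^ i))) =
        (1 + z_power (2 ^ k) + z_power (- (2 ^ k))) * G"
      unfolding G_def by (rule prod.remove[OF fin True])
    moreover have "Poly_Mapping.lookup ((1 + z_power (2 ^ k) + z_power (- (2 ^ k))) * G) e =
        Poly_Mapping.lookup G e + Poly_Mapping.lookup G (e - 2 ^ k) + Poly_Mapping.lookup G (e + 2 ^ k)" for e
      by (simp add: distrib_right lookup_add lookup_z_power_mult)
    ultimately show ?thesis using IH by simp
  next
    case False
    then have "S - {k} = S" by auto
    then show ?thesis using IH unfolding G_def by simp
  qed
qed

text \<open>The image \<open>1 + z + 1/z\<close> of the first variable.\<close>

abbreviation laurent_variable :: laurent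
  where "laurent_variable \<equiv> 1 + z_power 1 + z_power (-1)"

text \<open>
  The recursion \<open>u\<^sup>2 - 2 u = (u - 1)\<^sup>2 - 1\<close> squares \<open>z + 1/z\<close> and subtracts 2, which replaces \<open>z\<close> by
  \<open>z\<^sup>2\<close>.
\<close>

lemma chain_poly_laurent:
  "poly_subst laurent_variable (chain_poly k) = 1 + z_power (2 ^ k) + z_power (- (2 ^ k))"
proof (induction k)
  case (Suc k)
  let ?u = "z_power (2 ^ k)" and ?v = "z_power (- (2 ^ k))"
  have "poly_subst laurent_variable (chain_poly (Suc k)) = (1 + ?u + ?v) ^ 2 - 2 * (1 + ?u + ?v)"
    using Suc poly_subst_of_int[of laurent_variable 2]
    by (simp add: poly_subst_diff poly_subst_mult poly_subst_power)
  also have "\<dots> = ?u * ?u + ?v * ?v + 2 * (?u * ?v) - 1"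
    by (simp add: algebra_simps power2_eq_square)
  also have "\<dots> = 1 + z_power (2 ^ Suc k) + z_power (- (2 ^ Suc k))"
    by (simp add: mult_single)
  finally show ?case .
qed simp

lemma mpoly_eval_multilinear_eq_constant_term:
  assumes r: "multilinear N r"
  shows "mpoly_eval (\<lambda>_. 1) r =
    Poly_Mapping.lookup (poly_subst laurent_variable (eliminate r)) 0"
proof -
  let ?f = "\<lambda>i. 1 + z_power (2 ^ (i - 1)) + z_power (- (2 ^ (i - 1)))"
  have ct: "Poly_Mapping.lookup (of_int c * monomial_subst ?f m) 0 = c"
    if m: "m \<in> Poly_Mapping.keys r" for m c
  proof -
    let ?S = "Poly_Mapping.keys m"
    have sub: "?S \<subseteq> {1..N}" by (rule multilinear_keys[OF r m])
    have inj: "inj_on (\<lambda>i. i - 1) ?S"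
    proof (rule inj_onI)
      fix i j assume "i \<in> ?S" "j \<in> ?S" "i - 1 = j - 1"
      moreover from this have "i \<ge> 1" "j \<ge> 1" using sub by auto
      ultimately show "i = j" by simp
    qed
    have "monomial_subst ?f m = (\<Prod>i\<in>(\<lambda>i. i - 1) ` ?S. 1 + z_power (2 ^ i) + z_power (- (2 ^ i)))"
      unfolding multilinear_monomial_subst[OF r m] prod.reindex[OF inj] by simp
    then have "Poly_Mapping.lookup (monomial_subst ?f m) 0 = 1"
      using constant_term_prod[of "(\<lambda>i. i - 1) ` ?S" N] sub by fastforce
    then show ?thesis by (simp add: lookup_of_int_mult)
  qed
  have "poly_subst laurent_variable (eliminate r) = mpoly_subst ?f r"
    by (simp add: eliminate_def poly_subst_mpoly_subst chain_poly_laurent del: One_nat_def)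
  then have "Poly_Mapping.lookup (poly_subst laurent_variable (eliminate r)) 0 =
      (\<Sum>m\<in>Poly_Mapping.keys r. Poly_Mapping.lookup r m)"
    by (simp add: mpoly_subst_def lookup_sum ct del: One_nat_def)
  then show ?thesis by (simp add: mpoly_eval_def)
qed

text \<open>The Laurent polynomial \<open>2 + z + 1/z\<close> is \<open>(1 + z)\<^sup>2 / z\<close>.\<close>

lemma central_binomial_constant_term:
  "Poly_Mapping.lookup ((1 + laurent_variable) ^ k) 0 = int ((2 * k) choose k)"
proof -
  have "1 + laurent_variable = z_power (-1) * (z_power 1 + 1) ^ 2"
    by (simp add: power2_eq_square algebra_simps mult_single flip: mult.assoc)
  then have "(1 + laurent_variable) ^ k = z_power (- int k) * (z_power 1 + 1) ^ (2 * k)"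
    by (simp add: power_mult_distrib z_power_power power_mult)
  then have "Poly_Mapping.lookup ((1 + laurent_variable) ^ k) 0 =
      Poly_Mapping.lookup ((z_power 1 + 1) ^ (2 * k)) (int k)"
    by (simp add: lookup_z_power_mult)
  also have "\<dots> = (\<Sum>j\<le>2 * k. Poly_Mapping.lookup (of_nat ((2 * k) choose j) * z_power (int j)) (int k))"
    by (simp add: binomial_ring lookup_sum z_power_power)
  also have "\<dots> = (\<Sum>j\<le>2 * k. if j = k then int ((2 * k) choose j) else 0)"
    by (rule sum.cong[OF refl])
      (auto simp: mult_single lookup_single when_def simp flip: single_of_nat)
  finally show ?thesis by simp
qed

section \<open>The binomial transform\<close>

lemma lookup_binomial:
  fixes p :: laurent
  shows "Poly_Mapping.lookup ((p + of_int u) ^ n) e =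
    (\<Sum>k=0..n. int (n choose k) * u ^ (n - k) * Poly_Mapping.lookup (p ^ k) e)"
proof -
  have "(p + of_int u) ^ n = (\<Sum>k\<le>n. of_int (int (n choose k) * u ^ (n - k)) * p ^ k)"
    by (simp add: binomial_ring mult_ac)
  then show ?thesis
    by (simp only: lookup_sum lookup_of_int_mult atMost_atLeast0)
qed

text \<open>
  Once the sequence is represented umbrally as the coefficients of the powers of \<open>w\<close>, a single binomial
  transform amounts to replacing \<open>w\<close> by \<open>w + 1\<close>, and its inverse to replacing \<open>w\<close> by \<open>w - 1\<close>, by the
  binomial theorem.
\<close>

lemma binomial_transform_lookup_power:
  fixes w :: laurent
  shows "binomial_transform t (\<lambda>k. Poly_Mapping.lookup (w ^ k) e) n =
    Poly_Mapping.lookup ((of_int t + w) ^ n) e"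
proof (induction "nat \<bar>t\<bar>" arbitrary: t n)
  case 0
  then show ?case by (simp add: binomial_transform.simps)
next
  case (Suc d)
  consider "t > 0" | "t < 0" using Suc.hyps(2) by linarith
  then show ?case
  proof cases
    case 1
    have "binomial_transform t (\<lambda>k. Poly_Mapping.lookup (w ^ k) e) n =
       (\<Sum>k=0..n. int (n choose k) * binomial_transform (t - 1) (\<lambda>k. Poly_Mapping.lookup (w ^ k) e) k)"
      using 1 by (subst binomial_transform.simps) (auto simp: binomial_transform.simps[of 0])
    also have "\<dots> = (\<Sum>k=0..n. int (n choose k) * Poly_Mapping.lookup ((of_int (t - 1) + w) ^ k) e)"
      using Suc 1 by simp
    also have "\<dots> = Poly_Mapping.lookup ((of_int (t - 1) + w + of_int 1) ^ n) e"
      by (subst lookup_binomial) simp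
    finally show ?thesis by (simp add: algebra_simps)
  next
    case 2
    have "binomial_transform t (\<lambda>k. Poly_Mapping.lookup (w ^ k) e) n =
       (\<Sum>k=0..n. int (n choose k) * (-1) ^ (n - k) *
          binomial_transform (t + 1) (\<lambda>k. Poly_Mapping.lookup (w ^ k) e) k)"
      using 2 by (subst binomial_transform.simps) (auto simp: binomial_transform.simps[of 0])
    also have "\<dots> = (\<Sum>k=0..n. int (n choose k) * (-1) ^ (n - k) *
        Poly_Mapping.lookup ((of_int (t + 1) + w) ^ k) e)"
      using Suc 2 by simp
    also have "\<dots> = Poly_Mapping.lookup ((of_int (t + 1) + w + of_int (-1)) ^ n) e"
      by (subst lookup_binomial) simp
    finally show ?thesis by (simp add: algebra_simps)
  qed
qed

lemma less_two_power_of_floor_log: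
  assumes "n \<ge> 1" "int b = \<lfloor>log 2 (real n)\<rfloor> + 2"
  shows "n < 2 ^ b"
proof -
  have "log 2 (real n) < real b" using assms(2) by linarith
  then have "real n < 2 powr real b" using assms(1) by (simp add: log_less_iff)
  then have "real n < real (2 ^ b)" by (simp add: powr_realpow)
  then show ?thesis by linarith
qed

theorem proposition9:
  fixes n b :: nat and t :: int
  assumes "n \<ge> 1"
    and "int b = \<lfloor>log 2 (real n)\<rfloor> + 2"
  shows "mpoly_eval (\<lambda>_. 1) (expansion b (residue_class b (of_int (t + 1) + var 1) [^]\<^bsub>K b\<^esub> n))
    = binomial_transform t (\<lambda>k. int ((2 * k) choose k)) n"
proof -
  let ?h = "[:t + 1, 1:] ^ n"
  have "log 2 (real n) \<ge> 0" using assms(1) by (simp add: zero_le_log_cancel_iff)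
  then have b: "b \<ge> 1" using assms(2) by linarith
  have deg: "degree ?h < 2 ^ b"
    using less_two_power_of_floor_log[OF assms] by (simp add: degree_power_eq)
  have "of_int (t + 1) + var 1 \<in> carrier (poly_ring b)"
    using b by (intro add_closed of_int_closed var_closed) auto
  then have "residue_class b (of_int (t + 1) + var 1) [^]\<^bsub>K b\<^esub> n =
      residue_class b (poly_subst (var 1) ?h)"
    by (simp add: residue_class_power poly_subst_power del: One_nat_def)
  then have "mpoly_eval (\<lambda>_. 1) (expansion b (residue_class b (of_int (t + 1) + var 1) [^]\<^bsub>K b\<^esub> n)) =
      Poly_Mapping.lookup (poly_subst laurent_variable ?h) 0"
    using mpoly_eval_multilinear_eq_constant_term[OF expansion_representative(1)[OF b deg]]
      expansion_representative(2)[OF b deg] by simp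
  also have "poly_subst laurent_variable ?h = (of_int t + (1 + laurent_variable)) ^ n"
    by (simp add: poly_subst_power algebra_simps)
  also have "Poly_Mapping.lookup \<dots> 0 =
      binomial_transform t (\<lambda>k. Poly_Mapping.lookup ((1 + laurent_variable) ^ k) 0) n"
    by (rule binomial_transform_lookup_power[symmetric])
  also have "\<dots> = binomial_transform t (\<lambda>k. int ((2 * k) choose k)) n"
    by (simp only: central_binomial_constant_term)
  finally show ?thesis .
qed

end
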